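(* Let $\mathcal{A}$ be a $\mathbf{tDL}$-algebra. The lattice $C^{\uparrow}_t(X(A))$ of all upward closed $\mathbf{tPS}$-sets of $(X(A),R_A)$ is isomorphic to the dual of the lattice $\mathcal{F}_t(A)$ of all tense filters of $\mathcal{A}$; the anti-isomorphism is $Y\mapsto\varrho(Y)=\{a\in A:Y\subseteq\sigma_A(a)\}$, with inverse $S\mapsto\sigma(S)=\{T\in X(A):S\subseteq T\}$.
   Context: A $\mathbf{tDL}$-algebra is a bounded distributive lattice $\langle A,\wedge,\vee,0,1\rangle$ with unary operators $\mathbf{G},\mathbf{H},\mathbf{F},\mathbf{P}$ such that for all $x,y$: $\mathbf{G}1=\mathbf{H}1=1$; $\mathbf{G},\mathbf{H}$ preserve $\wedge$; $x\le\mathbf{G}\mathbf{P}x$, $x\le\mathbf{H}\mathbf{F}x$; $\mathbf{G}(x\vee y)\le\mathbf{G}x\vee\mathbf{F}y$, $\mathbf{H}(x\vee y)\le\mathbf{H}x\vee\mathbf{P}y$; $\mathbf{F}0=\mathbf{P}0=0$; $\mathbf{F},\mathbf{P}$ preserve $\vee$; $\mathbf{P}\mathbf{G}x\le x$, $\mathbf{F}\mathbf{H}x\le x$; $\mathbf{G}x\wedge\mathbf{F}y\le\mathbf{F}(x\wedge y)$, $\mathbf{H}x\wedge\mathbf{P}y\le\mathbf{P}(x\wedge y)$. A tense filter is a lattice filter $S$ with $\mathbf{G}x,\mathbf{H}x\in S$ for all $x\in S$. $X(A)$ is the set of prime filters ordered by inclusion with the Priestley topology generated by the sets $\sigma_A(a)=\{T\in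 X(A):a\in T\}$ and their complements; $(S,T)\in R_A$ iff $\{a:\mathbf{G}a\in S\}\subseteq T\subseteq\{a:\mathbf{F}a\in S\}$. With $R_A(x)=\{y:(x,y)\in R_A\}$, $R_A^{-1}(x)=\{y:(y,x)\in R_A\}$, a subset $Y\subseteq X(A)$ is a $\mathbf{tPS}$-set if for all $x,y$: (tc1) if $x\in R_A^{-1}(y)\cap Y$ then there are $w_1,w_2\in R_A(x)\cap Y$ with $w_1\subseteq y\subseteq w_2$; (tc2) if $x\in R_A(y)\cap Y$ then there are $w_1,w_2\in R_A^{-1}(x)\cap Y$ with $w_1\subseteq y\subseteq w_2$. $C^{\uparrow}_t(X(A))$ is the set of $\mathbf{tPS}$-sets that are closed and upward closed (w.r.t. inclusion). *)

theory Defs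
  imports "HOL-Analysis.Function_Topology" "HOL-Algebra.Lattice"
begin

(* sup, inf and top below are the operations of the type classes; the joins and meets
   of HOL-Algebra lattices are written with a subscript. *)
hide_const (open) Lattice.sup Lattice.inf Order.top

locale tDL_algebra =
  fixes G H F P :: "'a::{distrib_lattice, bounded_lattice} \<Rightarrow> 'a"
  assumes G_top: "G top = top"
    and H_top: "H top = top"
    and G_inf: "G (inf x y) = inf (G x) (G y)"
    and H_inf: "H (inf x y) = inf (H x) (H y)"
    and le_GP: "x \<le> G (P x)"
    and le_HF: "x \<le> H (F x)"
    and G_sup_le: "G (sup x y) \<le> sup (G x) (F y)"
    and H_sup_le: "H (sup x y) \<le> sup (H x) (P y)"
    and F_bot: "F bot = bot"
    and P_bot: "P bot = bot"
    and F_sup: "F (sup x y) = sup (F x) (F y)"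
    and P_sup: "P (sup x y) = sup (P x) (P y)"
    and PG_le: "P (G x) \<le> x"
    and FH_le: "F (H x) \<le> x"
    and G_inf_F_le: "inf (G x) (F y) \<le> F (inf x y)"
    and H_inf_P_le: "inf (H x) (P y) \<le> P (inf x y)"

(* Filters may be improper: UNIV is a filter. *)
definition lattice_filter :: "'a::bounded_lattice set \<Rightarrow> bool" where
  "lattice_filter S \<longleftrightarrow>
     top \<in> S \<and>
     (\<forall>x\<in>S. \<forall>y. x \<le> y \<longrightarrow> y \<in> S) \<and>
     (\<forall>x\<in>S. \<forall>y\<in>S. inf x y \<in> S)"

definition tense_filter ::
    "('a::bounded_lattice \<Rightarrow> 'a) \<Rightarrow> ('a \<Rightarrow> 'a) \<Rightarrow> 'a set \<Rightarrow> bool" where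
  "tense_filter G H S \<longleftrightarrow> lattice_filter S \<and> (\<forall>x\<in>S. G x \<in> S \<and> H x \<in> S)"

definition prime_filter :: "'a::bounded_lattice set \<Rightarrow> bool" where
  "prime_filter T \<longleftrightarrow>
     lattice_filter T \<and> T \<noteq> UNIV \<and> (\<forall>x y. sup x y \<in> T \<longrightarrow> x \<in> T \<or> y \<in> T)"

(* The underlying set of the dual space X(A). *)
definition prime_filters :: "'a::bounded_lattice set set" where
  "prime_filters = {T. prime_filter T}"

(* The map written sigma_A in the literature, on elements of A. *)
definition stone_map :: "'a::bounded_lattice \<Rightarrow> 'a set set" where
  "stone_map a = {T \<in> prime_filters. a \<in> T}"

definition priestley_topology :: "'a::bounded_lattice set topology" where
  "priestley_topology =
     topology_generated_by (range stone_map \<union> range (\<lambda>a. prime_filters - stone_map a))"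

definition tense_rel ::
    "('a::bounded_lattice \<Rightarrow> 'a) \<Rightarrow> ('a \<Rightarrow> 'a) \<Rightarrow> ('a set \<times> 'a set) set" where
  "tense_rel G F =
     {(S, T). S \<in> prime_filters \<and> T \<in> prime_filters \<and>
        {a. G a \<in> S} \<subseteq> T \<and> T \<subseteq> {a. F a \<in> S}}"

definition tPS_set :: "('a::bounded_lattice set \<times> 'a set) set \<Rightarrow> 'a set set \<Rightarrow> bool" where
  "tPS_set R Y \<longleftrightarrow>
     Y \<subseteq> prime_filters \<and>
     (\<forall>x\<in>prime_filters. \<forall>y\<in>prime_filters.
        (x \<in> R\<inverse> `` {y} \<inter> Y \<longrightarrow>
           (\<exists>w\<^sub>1 \<in> R `` {x} \<inter> Y. \<exists>w\<^sub>2 \<in> R `` {x} \<inter> Y. w\<^sub>1 \<subseteq> y \<and> y \<subseteq> w\<^sub>2)) \<and>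
        (x \<in> R `` {y} \<inter> Y \<longrightarrow>
           (\<exists>w\<^sub>1 \<in> R\<inverse> `` {x} \<inter> Y. \<exists>w\<^sub>2 \<in> R\<inverse> `` {x} \<inter> Y. w\<^sub>1 \<subseteq> y \<and> y \<subseteq> w\<^sub>2)))"

definition upward_closed :: "'a::bounded_lattice set set \<Rightarrow> bool" where
  "upward_closed Y \<longleftrightarrow> (\<forall>S\<in>Y. \<forall>T\<in>prime_filters. S \<subseteq> T \<longrightarrow> T \<in> Y)"

definition inclusion_order :: "'b set set \<Rightarrow> 'b set gorder" where
  "inclusion_order \<X> = \<lparr>carrier = \<X>, eq = (=), le = (\<subseteq>)\<rparr>"

definition closed_up_tPS_sets ::
    "('a::bounded_lattice \<Rightarrow> 'a) \<Rightarrow> ('a \<Rightarrow> 'a) \<Rightarrow> 'a set set gorder" where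
  "closed_up_tPS_sets G F =
     inclusion_order {Y. tPS_set (tense_rel G F) Y \<and>
       closedin priestley_topology Y \<and> upward_closed Y}"

definition tense_filters ::
    "('a::bounded_lattice \<Rightarrow> 'a) \<Rightarrow> ('a \<Rightarrow> 'a) \<Rightarrow> 'a set gorder" where
  "tense_filters G H = inclusion_order {S. tense_filter G H S}"

definition rho :: "'a::bounded_lattice set set \<Rightarrow> 'a set" where
  "rho Y = {a. Y \<subseteq> stone_map a}"

definition sigma :: "'a::bounded_lattice set \<Rightarrow> 'a set set" where
  "sigma S = {T \<in> prime_filters. S \<subseteq> T}"

definition lattice_iso :: "'b gorder \<Rightarrow> 'c gorder \<Rightarrow> ('b \<Rightarrow> 'c) \<Rightarrow> bool" where
  "lattice_iso L M f \<longleftrightarrow>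
     lattice L \<and> lattice M \<and> bij_betw f (carrier L) (carrier M) \<and>
     (\<forall>x\<in>carrier L. \<forall>y\<in>carrier L.
        f (x \<squnion>\<^bsub>L\<^esub> y) = f x \<squnion>\<^bsub>M\<^esub> f y \<and> f (x \<sqinter>\<^bsub>L\<^esub> y) = f x \<sqinter>\<^bsub>M\<^esub> f y)"

end

(* For upward closed sets the two tPS conditions amount to closure under R_A and its converse.
   The correspondence between filters and closed upward closed sets of prime filters is the
   classical Priestley one: it rests on separating filters from ideals by prime filters and on
   compactness. For a tense filter S, sigma S is closed under R_A and its converse by a direct
   computation. Conversely, if G a is missing from a prime filter T, a prime filter R_A-above T
   that misses a exists, because the filter {b. G b : T} and the ideal generated by a and
   {b. F b ~: T} are disjoint; the case of H is the same since R_A is also described by H and P. *)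
theory Submission
  imports Defs
begin

section \<open>Prime filters and the Priestley topology\<close>

lemma lattice_filterI:
  assumes "top \<in> S"
    and "\<And>x y. x \<in> S \<Longrightarrow> x \<le> y \<Longrightarrow> y \<in> S"
    and "\<And>x y. x \<in> S \<Longrightarrow> y \<in> S \<Longrightarrow> inf x y \<in> S"
  shows "lattice_filter S"
  using assms unfolding lattice_filter_def by blast

lemma lattice_filterD:
  assumes "lattice_filter S"
  shows lattice_filter_top: "top \<in> S"
    and lattice_filter_up: "x \<in> S \<Longrightarrow> x \<le> y \<Longrightarrow> y \<in> S"
    and lattice_filter_inf: "x \<in> S \<Longrightarrow> y \<in> S \<Longrightarrow> inf x y \<in> S"
  using assms unfolding lattice_filter_def by blast+

lemma lattice_filter_inf_iff:
  "lattice_filter S \<Longrightarrow> inf x y \<in> S \<longleftrightarrow> x \<in> S \<and> y \<in> S"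
  by (meson inf_le1 inf_le2 lattice_filter_inf lattice_filter_up)

lemma prime_filters_lattice_filter: "T \<in> prime_filters \<Longrightarrow> lattice_filter T"
  by (simp add: prime_filters_def prime_filter_def)

lemma prime_filters_bot: "T \<in> prime_filters \<Longrightarrow> bot \<notin> T"
  unfolding prime_filters_def prime_filter_def
  by (auto dest: lattice_filter_up[OF _ _ bot_least])

lemma prime_filters_sup_iff: "T \<in> prime_filters \<Longrightarrow> sup x y \<in> T \<longleftrightarrow> x \<in> T \<or> y \<in> T"
  unfolding prime_filters_def prime_filter_def
  by (auto intro: lattice_filter_up)

text \<open>The prime filter theorem for the filter \<open>S\<close> and the ideal \<open>I\<close>.
  Zorn's lemma gives a filter maximal among those that contain \<open>S\<close> and avoid
  \<open>I\<close>; maximality and distributivity make it prime.\<close>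

lemma prime_filter_separation:
  fixes S I :: "'a::{distrib_lattice, bounded_lattice} set"
  assumes S: "lattice_filter S"
    and bot: "bot \<in> I"
    and down: "\<And>x y. y \<in> I \<Longrightarrow> x \<le> y \<Longrightarrow> x \<in> I"
    and join: "\<And>x y. x \<in> I \<Longrightarrow> y \<in> I \<Longrightarrow> sup x y \<in> I"
    and disj: "S \<inter> I = {}"
  obtains T where "T \<in> prime_filters" "S \<subseteq> T" "T \<inter> I = {}"
proof -
  let ?A = "{U. lattice_filter U \<and> S \<subseteq> U \<and> U \<inter> I = {}}"
  have "\<exists>T\<in>?A. \<forall>U\<in>?A. T \<subseteq> U \<longrightarrow> U = T"
  proof (rule subset_Zorn_nonempty)
    show "?A \<noteq> {}"
      using S disj by blast
  next
    fix \<C> assume "\<C> \<noteq> {}" and chain: "subset.chain ?A \<C>"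
    have A: "\<C> \<subseteq> ?A" and cmp: "\<And>U V. U \<in> \<C> \<Longrightarrow> V \<in> \<C> \<Longrightarrow> U \<subseteq> V \<or> V \<subseteq> U"
      using chain unfolding subset.chain_def by blast+
    have "lattice_filter (\<Union>\<C>)"
    proof (rule lattice_filterI)
      show "top \<in> \<Union>\<C>"
        using \<open>\<C> \<noteq> {}\<close> A by (blast intro: lattice_filter_top)
    next
      fix x y assume "x \<in> \<Union>\<C>" "x \<le> y"
      then show "y \<in> \<Union>\<C>"
        using A by (blast intro: lattice_filter_up)
    next
      fix x y assume "x \<in> \<Union>\<C>" "y \<in> \<Union>\<C>"
      then obtain U V where "U \<in> \<C>" "x \<in> U" "V \<in> \<C>" "y \<in> V"
        by blast
      then obtain W where "W \<in> \<C>" "x \<in> W" "y \<in> W"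
        using cmp by blast
      then show "inf x y \<in> \<Union>\<C>"
        using A by (blast intro: lattice_filter_inf)
    qed
    then show "\<Union>\<C> \<in> ?A"
      using \<open>\<C> \<noteq> {}\<close> A by blast
  qed
  then obtain T where T: "lattice_filter T" "S \<subseteq> T" "T \<inter> I = {}"
    and maxA: "\<forall>U\<in>?A. T \<subseteq> U \<longrightarrow> U = T"
    by auto
  have max: "U = T" if "lattice_filter U" "U \<inter> I = {}" "T \<subseteq> U" for U
    using maxA that T(2) by simp
  \<comment> \<open>The filter \<open>?U\<close> generated by \<open>T\<close> and \<open>x\<close>
    is strictly larger than \<open>T\<close>, so by maximality it must meet \<open>I\<close>;
    \<open>I\<close> is a down-set, so some generator \<open>inf t x\<close> already lies in
    \<open>I\<close>.\<close>
  have ext: "\<exists>t\<in>T. inf t x \<in> I" if "x \<notin> T" for x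
  proof (rule ccontr)
    assume no: "\<not> ?thesis"
    let ?U = "{z. \<exists>t\<in>T. inf t x \<le> z}"
    have "lattice_filter ?U"
    proof (rule lattice_filterI)
      show "top \<in> ?U"
        using lattice_filter_top[OF T(1)] by auto
    next
      fix u v assume "u \<in> ?U" "u \<le> v"
      then show "v \<in> ?U"
        using order_trans by blast
    next
      fix u v assume "u \<in> ?U" "v \<in> ?U"
      then obtain s t where st: "s \<in> T" "t \<in> T" "inf s x \<le> u" "inf t x \<le> v"
        by blast
      have "inf (inf s t) x \<le> inf u v"
        using inf_mono[OF st(3,4)] by (simp add: ac_simps)
      then show "inf u v \<in> ?U"
        using lattice_filter_inf[OF T(1) st(1,2)] by blast
    qed
    moreover have "?U \<inter> I = {}"
      using no down by blast
    moreover have "T \<subseteq> ?U"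
      using inf_le1 by blast
    ultimately have "?U = T"
      by (rule max)
    moreover have "x \<in> ?U"
      using lattice_filter_top[OF T(1)] by auto
    ultimately show False
      using that by blast
  qed
  have "x \<in> T \<or> y \<in> T" if "sup x y \<in> T" for x y
  proof (rule ccontr)
    assume "\<not> ?thesis"
    then obtain s t where st: "s \<in> T" "inf s x \<in> I" "t \<in> T" "inf t y \<in> I"
      using ext by meson
    \<comment> \<open>A common multiplier for \<open>x\<close> and \<open>y\<close>: by
      distributivity \<open>inf ?r (sup x y)\<close> is a join of two elements of \<open>I\<close>,
      yet it belongs to \<open>T\<close>.\<close>
    let ?r = "inf s t"
    have "inf ?r x \<in> I" "inf ?r y \<in> I"
      using down[OF st(2), of "inf ?r x"] down[OF st(4), of "inf ?r y"]
      by (simp_all add: le_infI1)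
    then have "inf ?r (sup x y) \<in> I"
      using join by (simp add: inf_sup_distrib1)
    moreover have "inf ?r (sup x y) \<in> T"
      using st that by (simp add: lattice_filter_inf[OF T(1)])
    ultimately show False
      using T(3) by blast
  qed
  moreover have "T \<noteq> UNIV"
    using T(3) bot by blast
  ultimately have "T \<in> prime_filters"
    using T(1) by (auto simp: prime_filters_def prime_filter_def)
  then show thesis
    using T that by blast
qed

text \<open>Separation from the principal ideal of \<open>a\<close>, which a filter avoids as soon
  as it misses \<open>a\<close>.\<close>

lemma prime_filter_separation_point:
  fixes S :: "'a::{distrib_lattice, bounded_lattice} set"
  assumes "lattice_filter S" "a \<notin> S"
  obtains T where "T \<in> prime_filters" "S \<subseteq> T" "a \<notin> T"
proof (rule prime_filter_separation[where S = S and I = "{x. x \<le> a}"])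
  show "S \<inter> {x. x \<le> a} = {}"
    using assms by (auto dest: lattice_filter_up)
next
  fix x y assume "y \<in> {x. x \<le> a}" "x \<le> y"
  then show "x \<in> {x. x \<le> a}"
    by simp
next
  fix T assume "T \<in> prime_filters" "S \<subseteq> T" "T \<inter> {x. x \<le> a} = {}"
  then show thesis
    using that by blast
qed (simp_all add: assms)

section \<open>The clopen sets \<open>stone_map a\<close> and compactness of the dual space\<close>

lemma stone_map_top: "stone_map top = prime_filters"
  by (auto simp: stone_map_def intro: lattice_filter_top prime_filters_lattice_filter)

lemma stone_map_bot: "stone_map bot = {}"
  by (simp add: stone_map_def prime_filters_bot)

lemma stone_map_inf: "stone_map (inf x y) = stone_map x \<inter> stone_map y"
  by (auto simp: stone_map_def lattice_filter_inf_iff prime_filters_lattice_filter)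

lemma stone_map_sup: "stone_map (sup x y) = stone_map x \<union> stone_map y"
  by (auto simp: stone_map_def prime_filters_sup_iff)

lemma stone_map_mono: "x \<le> y \<Longrightarrow> stone_map x \<subseteq> stone_map y"
  by (auto simp: stone_map_def intro: lattice_filter_up prime_filters_lattice_filter)

lemma topspace_priestley_topology: "topspace priestley_topology = prime_filters"
  unfolding priestley_topology_def using stone_map_top
  by (auto simp: stone_map_def)

lemma openin_stone_map: "openin priestley_topology (stone_map a)"
  unfolding priestley_topology_def by (rule topology_generated_by_Basis) blast

lemma closedin_stone_map: "closedin priestley_topology (stone_map a)"
proof -
  have "openin priestley_topology (prime_filters - stone_map a)"
    unfolding priestley_topology_def by (rule topology_generated_by_Basis) blast
  then show ?thesis
    by (auto simp: closedin_def topspace_priestley_topology stone_map_def)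
qed

text \<open>Both sides are the coarsest topology in which the members of \<open>\<B>\<close> are
  open. This links \<open>topology_generated_by\<close> to the form of subbase used by
  \<open>Alexander_subbase\<close>.\<close>

lemma topology_subbase_eq_generated:
  "topology (arbitrary union_of (finite intersection_of (\<lambda>x. x \<in> \<B>) relative_to \<Union>\<B>))
   = topology_generated_by \<B>"
  (is "?X = ?Y")
proof (rule topology_eq[THEN iffD2], intro allI iffI)
  fix S assume "openin ?X S"
  then show "openin ?Y S"
    by (rule minimal_topology_subbase[rotated 2])
      (auto simp: topology_generated_by_Basis openin_topspace[of ?Y, simplified])
next
  have base: "openin ?X s" if "s \<in> \<B>" for s
  proof -
    have "(finite intersection_of (\<lambda>x. x \<in> \<B>) relative_to \<Union>\<B>) (\<Union>\<B> \<inter> s)"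
      by (intro relative_to_inc finite_intersection_of_inc that)
    moreover have "\<Union>\<B> \<inter> s = s"
      using that by blast
    ultimately show ?thesis
      by (simp add: openin_subbase arbitrary_union_of_inc)
  qed
  fix S assume "openin ?Y S"
  then have "generate_topology_on \<B> S"
    by (rule openin_topology_generated_by)
  then show "openin ?X S"
    using base by (rule generate_topology_on_coarsest[OF istopology_openin, rotated])
qed

text \<open>By Alexander's lemma only covers \<open>C\<close> by subbasic sets matter. Without a
  finite subcover, prime filter separation produces a point that no member of \<open>C\<close>
  contains.\<close>

lemma compact_space_priestley_topology:
  "compact_space (priestley_topology :: 'a::{distrib_lattice, bounded_lattice} set topology)"
  unfolding priestley_topology_def
proof (rule Alexander_subbase)
  let ?B = "range stone_map \<union> range (\<lambda>a::'a. prime_filters - stone_map a)"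
  show "topology (arbitrary union_of (finite intersection_of (\<lambda>x. x \<in> ?B) relative_to \<Union>?B))
    = topology_generated_by ?B"
    by (rule topology_subbase_eq_generated)
  have top: "topspace (topology_generated_by ?B) = prime_filters"
    using topspace_priestley_topology unfolding priestley_topology_def .
  fix C assume C: "C \<subseteq> ?B" and cover: "\<Union>C = topspace (topology_generated_by ?B)"
  show "\<exists>C'. finite C' \<and> C' \<subseteq> C \<and> \<Union>C' = topspace (topology_generated_by ?B)"
  proof (rule ccontr)
    assume "\<not> ?thesis"
    then have no: "\<not> prime_filters \<subseteq> \<Union>C'" if "finite C'" "C' \<subseteq> C" for C'
      using that cover top by (metis Union_mono subset_antisym)
    \<comment> \<open>\<open>I\<close> collects the \<open>x\<close> for which
      \<open>stone_map x\<close> is covered by finitely many members of \<open>C\<close>, and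
      \<open>S\<close> those for which its complement is. They form an ideal and a filter, and a
      common element would yield a finite subcover.\<close>
    define S where "S = {x. \<exists>D. finite D \<and> D \<subseteq> C \<and> prime_filters \<subseteq> \<Union>D \<union> stone_map x}"
    define I where "I = {x. \<exists>D. finite D \<and> D \<subseteq> C \<and> stone_map x \<subseteq> \<Union>D}"
    have "lattice_filter S"
    proof (rule lattice_filterI)
      show "top \<in> S"
        by (auto simp: S_def stone_map_top)
    next
      fix x y assume "x \<in> S" "x \<le> y"
      then show "y \<in> S"
        using stone_map_mono[of x y] unfolding S_def by blast
    next
      fix x y assume "x \<in> S" "y \<in> S"
      then obtain D E where "finite D" "D \<subseteq> C" "prime_filters \<subseteq> \<Union>D \<union> stone_map x"
        "finite E" "E \<subseteq> C" "prime_filters \<subseteq> \<Union>E \<union> stone_map y"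
        unfolding S_def by blast
      then have "finite (D \<union> E)" "D \<union> E \<subseteq> C"
        "prime_filters \<subseteq> \<Union>(D \<union> E) \<union> stone_map (inf x y)"
        unfolding stone_map_inf by blast+
      then show "inf x y \<in> S"
        unfolding S_def by blast
    qed
    moreover have "bot \<in> I"
      by (auto simp: I_def stone_map_bot)
    moreover have "x \<in> I" if "y \<in> I" "x \<le> y" for x y
      using that stone_map_mono[of x y] unfolding I_def by blast
    moreover have "sup x y \<in> I" if xy: "x \<in> I" "y \<in> I" for x y
    proof -
      obtain D E where "finite D" "D \<subseteq> C" "stone_map x \<subseteq> \<Union>D"
        "finite E" "E \<subseteq> C" "stone_map y \<subseteq> \<Union>E"
        using xy unfolding I_def by blast
      then have "finite (D \<union> E)" "D \<union> E \<subseteq> C" "stone_map (sup x y) \<subseteq> \<Union>(D \<union> E)"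
        unfolding stone_map_sup by blast+
      then show ?thesis
        unfolding I_def by blast
    qed
    moreover have "S \<inter> I = {}"
    proof (rule ccontr)
      assume "S \<inter> I \<noteq> {}"
      then obtain x D E where "finite D" "D \<subseteq> C" "prime_filters \<subseteq> \<Union>D \<union> stone_map x"
        "finite E" "E \<subseteq> C" "stone_map x \<subseteq> \<Union>E"
        unfolding S_def I_def by blast
      then have "finite (D \<union> E)" "D \<union> E \<subseteq> C" "prime_filters \<subseteq> \<Union>(D \<union> E)"
        by blast+
      then show False
        using no by blast
    qed
    ultimately obtain T where T: "T \<in> prime_filters" "S \<subseteq> T" "T \<inter> I = {}"
      by (rule prime_filter_separation)
    then obtain c where c: "c \<in> C" "T \<in> c"
      using cover top by blast
    then consider a where "c = stone_map a" | a where "c = prime_filters - stone_map a"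
      using C by blast
    then show False
    proof cases
      case (1 a)
      \<comment> \<open>The singleton \<open>{c}\<close> is already a finite cover of
        \<open>stone_map a\<close>; in the other case it covers the complement and puts
        \<open>a\<close> into \<open>S\<close>.\<close>
      then have "a \<in> I"
        unfolding I_def using c(1) by (auto intro!: exI[of _ "{c}"])
      then show False
        using 1 c(2) T(3) by (auto simp: stone_map_def)
    next
      case (2 a)
      then have "a \<in> S"
        unfolding S_def using c(1) by (auto intro!: exI[of _ "{c}"])
      then show False
        using 2 c(2) T(2) by (auto simp: stone_map_def)
    qed
  qed
qed

section \<open>The correspondence between filters and closed upward closed sets\<close>

lemma rho_mem_iff:
  assumes "Y \<subseteq> prime_filters"
  shows "a \<in> rho Y \<longleftrightarrow> (\<forall>T\<in>Y. a \<in> T)"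
  using assms by (auto simp: rho_def stone_map_def)

lemma rho_antimono: "Y \<subseteq> Z \<Longrightarrow> rho Z \<subseteq> rho Y"
  by (auto simp: rho_def)

lemma sigma_antimono: "S \<subseteq> S' \<Longrightarrow> sigma S' \<subseteq> sigma S"
  by (auto simp: sigma_def)

lemma lattice_filter_rho: "Y \<subseteq> prime_filters \<Longrightarrow> lattice_filter (rho Y)"
  by (rule lattice_filterI)
    (auto simp: rho_def stone_map_top stone_map_inf dest: subsetD[OF stone_map_mono])

lemma upward_closed_sigma: "upward_closed (sigma S)"
  by (auto simp: upward_closed_def sigma_def)

lemma closedin_sigma: "closedin priestley_topology (sigma S)"
proof -
  have "sigma S = topspace priestley_topology \<inter> \<Inter>(stone_map ` S)"
    by (auto simp: sigma_def stone_map_def topspace_priestley_topology)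
  \<comment> \<open>Inserting the whole space keeps the intersected family nonempty when
    \<open>S\<close> is empty.\<close>
  also have "closedin priestley_topology \<dots>"
    using closedin_Inter[of "insert (topspace priestley_topology) (stone_map ` S)"
        priestley_topology]
    by (simp add: closedin_stone_map ball_Un image_iff) (use closedin_stone_map in blast)
  finally show ?thesis .
qed

text \<open>\<open>rho (sigma S)\<close> is the intersection of all prime filters containing
  \<open>S\<close>, and separation of points shows that this adds nothing to
  \<open>S\<close>.\<close>

lemma rho_sigma:
  fixes S :: "'a::{distrib_lattice, bounded_lattice} set"
  assumes "lattice_filter S"
  shows "rho (sigma S) = S"
proof
  show "rho (sigma S) \<subseteq> S"
  proof
    fix a assume a: "a \<in> rho (sigma S)"
    show "a \<in> S"
    proof (rule ccontr)
      assume "a \<notin> S"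
      with assms obtain T where "T \<in> prime_filters" "S \<subseteq> T" "a \<notin> T"
        by (rule prime_filter_separation_point)
      then show False
        using a by (auto simp: rho_def sigma_def stone_map_def)
    qed
  qed
qed (auto simp: rho_def sigma_def stone_map_def)

text \<open>The witness is the join of \<open>A\<close>, with \<open>bot\<close> for the empty set;
  it stays outside \<open>T\<close> because \<open>T\<close> is prime.\<close>

lemma prime_filter_finite_Union_stone_map:
  assumes T: "T \<in> prime_filters" and "finite A" "A \<inter> T = {}"
  obtains a where "a \<notin> T" "\<Union>(stone_map ` A) \<subseteq> stone_map a"
proof -
  have "\<exists>a. a \<notin> T \<and> \<Union>(stone_map ` A) \<subseteq> stone_map a"
    using assms(2,3)
  proof (induction A)
    case empty
    then show ?case
      using prime_filters_bot[OF T] by auto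
  next
    case (insert x A)
    then obtain a where "a \<notin> T" "\<Union>(stone_map ` A) \<subseteq> stone_map a"
      by auto
    then show ?case
      using insert.prems
      by (intro exI[of _ "sup x a"]) (auto simp: prime_filters_sup_iff[OF T] stone_map_sup)
  qed
  then show thesis
    using that by blast
qed

text \<open>Suppose \<open>T\<close> contains \<open>rho Y\<close> but is not in \<open>Y\<close>.
  The open sets \<open>stone_map a\<close> with \<open>a\<close> outside \<open>T\<close> cover
  \<open>Y\<close>; by compactness, a single such \<open>a\<close> suffices. Then \<open>a\<close>
  is in \<open>rho Y\<close>, hence in \<open>T\<close>, a contradiction.\<close>

lemma sigma_rho:
  fixes Y :: "'a::{distrib_lattice, bounded_lattice} set set"
  assumes closed: "closedin priestley_topology Y" and up: "upward_closed Y"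
  shows "sigma (rho Y) = Y"
proof
  have Y: "Y \<subseteq> prime_filters"
    using closedin_subset[OF closed] by (simp add: topspace_priestley_topology)
  then show "Y \<subseteq> sigma (rho Y)"
    by (auto simp: sigma_def rho_def stone_map_def)
  show "sigma (rho Y) \<subseteq> Y"
  proof
    fix T assume T: "T \<in> sigma (rho Y)"
    then have TP: "T \<in> prime_filters" and Trho: "rho Y \<subseteq> T"
      by (auto simp: sigma_def)
    show "T \<in> Y"
    proof (rule ccontr)
      assume "T \<notin> Y"
      \<comment> \<open>As \<open>Y\<close> is upward closed, no member of \<open>Y\<close> is
        included in \<open>T\<close>, so each has an element outside \<open>T\<close>.\<close>
      then have "Y \<subseteq> \<Union>(stone_map ` (- T))"
        using Y up TP by (fastforce simp: upward_closed_def stone_map_def)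
      moreover have "compactin priestley_topology Y"
        using closed compact_space_priestley_topology by (rule closedin_compact_space[rotated])
      ultimately obtain \<F> where "finite \<F>" "\<F> \<subseteq> stone_map ` (- T)" "Y \<subseteq> \<Union>\<F>"
        unfolding compactin_def using openin_stone_map by (metis imageE)
      then obtain A where A: "A \<subseteq> - T" "finite A" "Y \<subseteq> \<Union>(stone_map ` A)"
        by (metis finite_subset_image)
      then have "A \<inter> T = {}"
        by blast
      with TP A(2) obtain a where "a \<notin> T" "\<Union>(stone_map ` A) \<subseteq> stone_map a"
        by (rule prime_filter_finite_Union_stone_map)
      then have "a \<in> rho Y"
        using A(3) by (simp add: rho_def)
      then show False
        using Trho \<open>a \<notin> T\<close> by blast
    qed
  qed
qed

section \<open>Tense operators and the relation\<close>

text \<open>Upward closure turns the lower witness into membership of the point above it.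
  Conversely, if \<open>Y\<close> is invariant under \<open>R\<close> in both directions, the point
  itself serves as both witnesses.\<close>

lemma tPS_set_upward_closed_iff:
  assumes "upward_closed Y"
  shows "tPS_set R Y \<longleftrightarrow> Y \<subseteq> prime_filters \<and>
    (\<forall>x\<in>prime_filters. \<forall>y\<in>prime_filters. (x, y) \<in> R \<longrightarrow> (x \<in> Y \<longleftrightarrow> y \<in> Y))"
  (is "_ \<longleftrightarrow> ?Q")
proof
  assume tPS: "tPS_set R Y"
  have "x \<in> Y \<longleftrightarrow> y \<in> Y"
    if "x \<in> prime_filters" "y \<in> prime_filters" "(x, y) \<in> R" for x y
  proof
    assume "x \<in> Y"
    then have "\<exists>w \<in> R `` {x} \<inter> Y. w \<subseteq> y"
      using tPS that unfolding tPS_set_def by blast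
    then show "y \<in> Y"
      using assms that by (auto simp: upward_closed_def)
  next
    assume "y \<in> Y"
    then have "\<exists>w \<in> R\<inverse> `` {y} \<inter> Y. w \<subseteq> x"
      using tPS that unfolding tPS_set_def by blast
    then show "x \<in> Y"
      using assms that by (auto simp: upward_closed_def)
  qed
  moreover have "Y \<subseteq> prime_filters"
    using tPS by (simp add: tPS_set_def)
  ultimately show ?Q
    by simp
next
  assume Q: ?Q
  show "tPS_set R Y"
    unfolding tPS_set_def
  proof (intro conjI ballI impI)
    show "Y \<subseteq> prime_filters"
      using Q by simp
  next
    fix x y assume "x \<in> prime_filters" "y \<in> prime_filters" "x \<in> R\<inverse> `` {y} \<inter> Y"
    then have "y \<in> R `` {x} \<inter> Y"
      using Q by auto
    then show "\<exists>w\<^sub>1 \<in> R `` {x} \<inter> Y. \<exists>w\<^sub>2 \<in> R `` {x} \<inter> Y. w\<^sub>1 \<subseteq> y \<and> y \<subseteq> w\<^sub>2"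
      by (metis order_refl)
  next
    fix x y assume "x \<in> prime_filters" "y \<in> prime_filters" "x \<in> R `` {y} \<inter> Y"
    then have "y \<in> R\<inverse> `` {x} \<inter> Y"
      using Q by auto
    then show "\<exists>w\<^sub>1 \<in> R\<inverse> `` {x} \<inter> Y. \<exists>w\<^sub>2 \<in> R\<inverse> `` {x} \<inter> Y. w\<^sub>1 \<subseteq> y \<and> y \<subseteq> w\<^sub>2"
      by (metis order_refl)
  qed
qed

context tDL_algebra
begin

lemma G_mono: "x \<le> y \<Longrightarrow> G x \<le> G y"
  by (metis G_inf inf.absorb_iff2)

text \<open>The axioms are symmetric under exchanging past and future. Each fact proved for
  \<open>G\<close> and \<open>F\<close> thus has a counterpart for \<open>H\<close> and
  \<open>P\<close>.\<close>

lemma tDL_algebra_mirror: "tDL_algebra H G P F"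
  by unfold_locales
    (rule G_top H_top G_inf H_inf le_GP le_HF G_sup_le H_sup_le F_bot P_bot F_sup P_sup
      PG_le FH_le G_inf_F_le H_inf_P_le)+

text \<open>Rests on the adjunction inequalities: if \<open>H a\<close> is in \<open>S\<close>, then
  \<open>F (H a)\<close>, and so \<open>a\<close>, is in \<open>T\<close>; if \<open>a\<close> is in
  \<open>T\<close>, then so is \<open>G (P a)\<close>, whence \<open>P a\<close> is in
  \<open>S\<close>.\<close>

lemma tense_rel_converse_subset: "(T, S) \<in> tense_rel G F \<Longrightarrow> (S, T) \<in> tense_rel H P"
proof -
  assume TS: "(T, S) \<in> tense_rel G F"
  then have filters: "lattice_filter T" "lattice_filter S"
    by (auto simp: tense_rel_def prime_filters_lattice_filter)
  have "a \<in> T" if "H a \<in> S" for a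
    using TS that FH_le[of a] lattice_filter_up[OF filters(1)] by (auto simp: tense_rel_def)
  moreover have "P a \<in> S" if "a \<in> T" for a
    using TS that le_GP[of a] lattice_filter_up[OF filters(1)] by (auto simp: tense_rel_def)
  ultimately show ?thesis
    using TS by (auto simp: tense_rel_def)
qed

text \<open>The filter \<open>?S\<close> and the ideal \<open>?I\<close> are disjoint by
  \<open>G_sup_le\<close>: from \<open>g \<le> sup a b\<close> follows
  \<open>G g \<le> sup (G a) (F b)\<close>, and the prime filter \<open>T\<close> contains neither
  \<open>G a\<close> nor \<open>F b\<close>.\<close>

lemma tense_rel_separation:
  assumes T: "T \<in> prime_filters" and a: "G a \<notin> T"
  obtains U where "(T, U) \<in> tense_rel G F" "a \<notin> U"
proof -
  \<comment> \<open>One \<open>b\<close> suffices to describe the generated ideal \<open>?I\<close>,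
    since the elements with \<open>F b\<close> outside \<open>T\<close> are closed under
    joins.\<close>
  let ?S = "{b. G b \<in> T}" and ?I = "{x. \<exists>b. F b \<notin> T \<and> x \<le> sup b a}"
  note filter = prime_filters_lattice_filter[OF T]
  have S: "lattice_filter ?S"
    by (rule lattice_filterI)
      (auto simp: G_top G_inf lattice_filter_top[OF filter] lattice_filter_inf[OF filter]
        intro: lattice_filter_up[OF filter] G_mono)
  have Fbot: "F bot \<notin> T"
    using prime_filters_bot[OF T] by (simp add: F_bot)
  then have "bot \<in> ?I"
    using bot_least by blast
  moreover have "x \<in> ?I" if "y \<in> ?I" "x \<le> y" for x y
    using that order_trans by blast
  moreover have "sup x y \<in> ?I" if xy: "x \<in> ?I" "y \<in> ?I" for x y
  proof -
    obtain b c where bc: "F b \<notin> T" "F c \<notin> T" "x \<le> sup b a" "y \<le> sup c a"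
      using xy by blast
    then have "F (sup b c) \<notin> T"
      by (simp add: F_sup prime_filters_sup_iff[OF T])
    moreover have "sup x y \<le> sup (sup b c) a"
      using sup_mono[OF bc(3,4)] by (simp add: ac_simps)
    ultimately show ?thesis
      by blast
  qed
  moreover have "?S \<inter> ?I = {}"
  proof (rule ccontr)
    assume "?S \<inter> ?I \<noteq> {}"
    then obtain g b where gb: "G g \<in> T" "F b \<notin> T" "g \<le> sup a b"
      by (auto simp: sup.commute)
    then have "G g \<le> sup (G a) (F b)"
      by (meson G_mono G_sup_le order_trans)
    then have "sup (G a) (F b) \<in> T"
      using gb(1) by (blast intro: lattice_filter_up[OF filter])
    then show False
      using a gb(2) by (simp add: prime_filters_sup_iff[OF T])
  qed
  ultimately obtain U where U: "U \<in> prime_filters" "?S \<subseteq> U" "U \<inter> ?I = {}"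
    by (rule prime_filter_separation[OF S])
  \<comment> \<open>Take \<open>b = bot\<close>. Likewise every \<open>b\<close> with
    \<open>F b\<close> outside \<open>T\<close> lies in \<open>?I\<close>, which gives the upper
    bound on \<open>U\<close> in the definition of the relation.\<close>
  have "a \<in> ?I"
    using Fbot sup.cobounded2 by blast
  then have "a \<notin> U"
    using U(3) by blast
  moreover have "U \<subseteq> {b. F b \<in> T}"
    using U(3) sup.cobounded1 by blast
  ultimately show thesis
    using T U(1,2) that by (simp add: tense_rel_def)
qed

text \<open>If some \<open>T\<close> in \<open>Y\<close> missed \<open>G a\<close>, it would have a
  successor missing \<open>a\<close>; that successor is in \<open>Y\<close>, against
  \<open>a\<close> being in \<open>rho Y\<close>.\<close>

lemma G_mem_rho:
  assumes "Y \<subseteq> prime_filters"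
    and "\<And>x y. (x, y) \<in> tense_rel G F \<Longrightarrow> x \<in> Y \<Longrightarrow> y \<in> Y"
    and "a \<in> rho Y"
  shows "G a \<in> rho Y"
proof (rule ccontr)
  assume "G a \<notin> rho Y"
  then obtain T where T: "T \<in> Y" "G a \<notin> T"
    using assms(1) by (auto simp: rho_mem_iff)
  then obtain U where "(T, U) \<in> tense_rel G F" "a \<notin> U"
    using assms(1) by (meson subsetD tense_rel_separation)
  then show False
    using assms T(1) by (auto simp: rho_mem_iff)
qed

text \<open>For \<open>s\<close> in \<open>S\<close> also \<open>G s\<close> is in \<open>S\<close>,
  hence in \<open>x\<close>, and so \<open>s\<close> is in \<open>y\<close>.\<close>

lemma sigma_step:
  assumes "tense_filter G H S" "(x, y) \<in> tense_rel G F" "x \<in> sigma S"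
  shows "y \<in> sigma S"
  using assms by (auto simp: tense_filter_def tense_rel_def sigma_def)

end

section \<open>Tense filters against closed upward closed tPS-sets\<close>

context tDL_algebra
begin

interpretation mirror: tDL_algebra H G P F
  by (rule tDL_algebra_mirror)

text \<open>Through this identity the mirrored lemmas speak about predecessors under the same
  relation.\<close>

lemma tense_rel_mirror: "tense_rel H P = (tense_rel G F)\<inverse>"
  using tense_rel_converse_subset mirror.tense_rel_converse_subset by auto

text \<open>Trades the witness conditions for invariance under the relation, the form used from here
  on.\<close>

lemma carrier_closed_up_tPS_sets_iff:
  "Y \<in> carrier (closed_up_tPS_sets G F) \<longleftrightarrow>
    closedin priestley_topology Y \<and> upward_closed Y \<and>
    (\<forall>(x, y)\<in>tense_rel G F. x \<in> Y \<longleftrightarrow> y \<in> Y)"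
proof -
  have "Y \<subseteq> prime_filters" if "closedin priestley_topology Y"
    using closedin_subset[OF that] by (simp add: topspace_priestley_topology)
  moreover have "tense_rel G F \<subseteq> prime_filters \<times> prime_filters"
    by (auto simp: tense_rel_def)
  ultimately show ?thesis
    unfolding closed_up_tPS_sets_def inclusion_order_def
    using tPS_set_upward_closed_iff[of Y "tense_rel G F"] by auto
qed

lemma rho_closed:
  assumes "Y \<in> carrier (closed_up_tPS_sets G F)"
  shows "rho Y \<in> carrier (tense_filters G H)"
proof -
  have closed: "closedin priestley_topology Y"
    and rel: "\<And>x y. (x, y) \<in> tense_rel G F \<Longrightarrow> x \<in> Y \<longleftrightarrow> y \<in> Y"
    using assms by (auto simp: carrier_closed_up_tPS_sets_iff)
  have Y: "Y \<subseteq> prime_filters"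
    using closedin_subset[OF closed] by (simp add: topspace_priestley_topology)
  have "G a \<in> rho Y" if "a \<in> rho Y" for a
    using Y _ that by (rule G_mem_rho) (simp add: rel)
  moreover have "H a \<in> rho Y" if "a \<in> rho Y" for a
    using Y _ that by (rule mirror.G_mem_rho) (simp add: tense_rel_mirror rel)
  ultimately show ?thesis
    using lattice_filter_rho[OF Y]
    by (simp add: tense_filters_def inclusion_order_def tense_filter_def)
qed

lemma sigma_closed:
  assumes "S \<in> carrier (tense_filters G H)"
  shows "sigma S \<in> carrier (closed_up_tPS_sets G F)"
proof -
  \<comment> \<open>The second form feeds \<open>mirror.sigma_step\<close>, which gives invariance
    of \<open>sigma S\<close> towards predecessors.\<close>
  have "tense_filter G H S" "tense_filter H G S"
    using assms by (auto simp: tense_filters_def inclusion_order_def tense_filter_def)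
  then show ?thesis
    using sigma_step mirror.sigma_step
    by (auto simp: carrier_closed_up_tPS_sets_iff closedin_sigma upward_closed_sigma
        tense_rel_mirror)
qed

lemma rho_sigma_tense_filter: "S \<in> carrier (tense_filters G H) \<Longrightarrow> rho (sigma S) = S"
  by (simp add: tense_filters_def inclusion_order_def tense_filter_def rho_sigma)

lemma sigma_rho_closed_up_tPS: "Y \<in> carrier (closed_up_tPS_sets G F) \<Longrightarrow> sigma (rho Y) = Y"
  by (simp add: carrier_closed_up_tPS_sets_iff sigma_rho)

end

section \<open>Lattices\<close>

text \<open>Joins are required only as least upper bounds, because the join of two tense filters
  need not be their union.\<close>

lemma lattice_inclusion_order:
  assumes "\<And>x y. x \<in> \<X> \<Longrightarrow> y \<in> \<X> \<Longrightarrow>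
      \<exists>s\<in>\<X>. x \<subseteq> s \<and> y \<subseteq> s \<and> (\<forall>z\<in>\<X>. x \<subseteq> z \<longrightarrow> y \<subseteq> z \<longrightarrow> s \<subseteq> z)"
    and "\<And>x y. x \<in> \<X> \<Longrightarrow> y \<in> \<X> \<Longrightarrow> x \<inter> y \<in> \<X>"
  shows "lattice (inclusion_order \<X>)"
proof -
  let ?L = "inclusion_order \<X>"
  show ?thesis
  proof
    fix x y assume xy: "x \<in> carrier ?L" "y \<in> carrier ?L"
    then obtain s where "s \<in> \<X>" "x \<subseteq> s" "y \<subseteq> s"
      "\<forall>z\<in>\<X>. x \<subseteq> z \<longrightarrow> y \<subseteq> z \<longrightarrow> s \<subseteq> z"
      using assms(1)[of x y] by (auto simp: inclusion_order_def)
    then have "least ?L s (Upper ?L {x, y})"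
      using xy by (auto simp: least_def Upper_def inclusion_order_def)
    then show "\<exists>s. least ?L s (Upper ?L {x, y})" ..
    have "greatest ?L (x \<inter> y) (Lower ?L {x, y})"
      using xy assms(2)[of x y] by (auto simp: greatest_def Lower_def inclusion_order_def)
    then show "\<exists>s. greatest ?L s (Lower ?L {x, y})" ..
  qed (auto simp: inclusion_order_def)
qed

lemma lattice_inv_gorder:
  assumes "lattice L"
  shows "lattice (inv_gorder L)"
proof -
  interpret lattice L by fact
  interpret dual: partial_order "inv_gorder L"
    by (rule dual_order)
  show ?thesis
    by unfold_locales (simp_all add: inf_of_two_exists sup_of_two_exists)
qed

text \<open>Mutually inverse monotone maps preserve joins and meets: \<open>g\<close> carries a
  bound of \<open>f x\<close> and \<open>f y\<close> back to a bound of \<open>x\<close> and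
  \<open>y\<close>.\<close>

lemma lattice_iso_of_order_iso:
  assumes L: "lattice L" and M: "lattice M"
    and f: "\<And>x. x \<in> carrier L \<Longrightarrow> f x \<in> carrier M"
    and g: "\<And>y. y \<in> carrier M \<Longrightarrow> g y \<in> carrier L"
    and gf: "\<And>x. x \<in> carrier L \<Longrightarrow> g (f x) = x"
    and fg: "\<And>y. y \<in> carrier M \<Longrightarrow> f (g y) = y"
    and f_mono: "\<And>x y. x \<in> carrier L \<Longrightarrow> y \<in> carrier L \<Longrightarrow> x \<sqsubseteq>\<^bsub>L\<^esub> y \<Longrightarrow> f x \<sqsubseteq>\<^bsub>M\<^esub> f y"
    and g_mono: "\<And>x y. x \<in> carrier M \<Longrightarrow> y \<in> carrier M \<Longrightarrow> x \<sqsubseteq>\<^bsub>M\<^esub> y \<Longrightarrow> g x \<sqsubseteq>\<^bsub>L\<^esub> g y"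
  shows "lattice_iso L M f"
proof -
  interpret L: lattice L by fact
  interpret M: lattice M by fact
  have bij: "bij_betw f (carrier L) (carrier M)"
    by (rule bij_betw_byWitness[where f' = g]) (use f g gf fg in auto)
  have join: "f (x \<squnion>\<^bsub>L\<^esub> y) = f x \<squnion>\<^bsub>M\<^esub> f y" if x: "x \<in> carrier L" and y: "y \<in> carrier L" for x y
  proof (rule M.le_antisym)
    let ?m = "f x \<squnion>\<^bsub>M\<^esub> f y"
    have m: "?m \<in> carrier M"
      using f x y by simp
    have "x \<sqsubseteq>\<^bsub>L\<^esub> g ?m"
      using g_mono[OF f[OF x] m M.join_left] f gf x y by simp
    moreover have "y \<sqsubseteq>\<^bsub>L\<^esub> g ?m"
      using g_mono[OF f[OF y] m M.join_right] f gf x y by simp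
    ultimately have "x \<squnion>\<^bsub>L\<^esub> y \<sqsubseteq>\<^bsub>L\<^esub> g ?m"
      using x y g[OF m] by (rule L.join_le)
    then show "f (x \<squnion>\<^bsub>L\<^esub> y) \<sqsubseteq>\<^bsub>M\<^esub> ?m"
      using f_mono[OF L.join_closed[OF x y] g[OF m]] fg[OF m] by simp
    show "?m \<sqsubseteq>\<^bsub>M\<^esub> f (x \<squnion>\<^bsub>L\<^esub> y)"
      using x y f f_mono L.join_left L.join_right by (simp add: M.join_le)
  qed (use x y f in simp_all)
  have meet: "f (x \<sqinter>\<^bsub>L\<^esub> y) = f x \<sqinter>\<^bsub>M\<^esub> f y" if x: "x \<in> carrier L" and y: "y \<in> carrier L" for x y
  proof (rule M.le_antisym)
    let ?m = "f x \<sqinter>\<^bsub>M\<^esub> f y"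
    have m: "?m \<in> carrier M"
      using f x y by simp
    have "g ?m \<sqsubseteq>\<^bsub>L\<^esub> x"
      using g_mono[OF m f[OF x] M.meet_left] f gf x y by simp
    moreover have "g ?m \<sqsubseteq>\<^bsub>L\<^esub> y"
      using g_mono[OF m f[OF y] M.meet_right] f gf x y by simp
    ultimately have "g ?m \<sqsubseteq>\<^bsub>L\<^esub> x \<sqinter>\<^bsub>L\<^esub> y"
      using x y g[OF m] by (rule L.meet_le)
    then show "?m \<sqsubseteq>\<^bsub>M\<^esub> f (x \<sqinter>\<^bsub>L\<^esub> y)"
      using f_mono[OF g[OF m] L.meet_closed[OF x y]] fg[OF m] by simp
    show "f (x \<sqinter>\<^bsub>L\<^esub> y) \<sqsubseteq>\<^bsub>M\<^esub> ?m"
      using x y f f_mono L.meet_left L.meet_right by (simp add: M.meet_le)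
  qed (use x y f in simp_all)
  show ?thesis
    unfolding lattice_iso_def using L M bij join meet by blast
qed

section \<open>The two lattices and their anti-isomorphism\<close>

lemma lattice_tense_filters: "lattice (tense_filters G H)"
  unfolding tense_filters_def
proof (rule lattice_inclusion_order)
  have Inter: "tense_filter G H (\<Inter>\<C>)" if "\<And>S. S \<in> \<C> \<Longrightarrow> tense_filter G H S" for \<C>
  proof -
    have filter: "lattice_filter S" and GH: "x \<in> S \<Longrightarrow> G x \<in> S \<and> H x \<in> S" if "S \<in> \<C>" for S x
      using \<open>\<And>S. S \<in> \<C> \<Longrightarrow> tense_filter G H S\<close>[OF that] by (simp_all add: tense_filter_def)
    have "lattice_filter (\<Inter>\<C>)"
      by (rule lattice_filterI) (auto dest: filter intro: lattice_filterD)
    then show ?thesis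
      using GH by (simp add: tense_filter_def)
  qed
  fix S S' assume SS': "S \<in> {S. tense_filter G H S}" "S' \<in> {S. tense_filter G H S}"
  show "S \<inter> S' \<in> {S. tense_filter G H S}"
    using Inter[of "{S, S'}"] SS' by auto
  \<comment> \<open>The tense filter generated by \<open>S\<close> and \<open>S'\<close>, which is
    their join.\<close>
  let ?J = "\<Inter>{U. tense_filter G H U \<and> S \<subseteq> U \<and> S' \<subseteq> U}"
  have "tense_filter G H ?J"
    by (rule Inter) blast
  then show "\<exists>J\<in>{S. tense_filter G H S}. S \<subseteq> J \<and> S' \<subseteq> J \<and>
      (\<forall>z\<in>{S. tense_filter G H S}. S \<subseteq> z \<longrightarrow> S' \<subseteq> z \<longrightarrow> J \<subseteq> z)"
    by (intro bexI[of _ ?J]) auto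
qed

text \<open>Invariance under the relation, closedness and upward closure all survive binary unions
  and intersections, so these are the lattice operations.\<close>

lemma (in tDL_algebra) lattice_closed_up_tPS_sets: "lattice (closed_up_tPS_sets G F)"
proof -
  let ?\<X> = "carrier (closed_up_tPS_sets G F)"
  have "Y \<union> Z \<in> ?\<X>" "Y \<inter> Z \<in> ?\<X>" if "Y \<in> ?\<X>" "Z \<in> ?\<X>" for Y Z
    using that unfolding carrier_closed_up_tPS_sets_iff
    by (auto simp: closedin_Un closedin_Int upward_closed_def)
  then have "lattice (inclusion_order ?\<X>)"
    by (intro lattice_inclusion_order) (meson Un_least Un_upper1 Un_upper2)+
  then show ?thesis
    by (simp add: closed_up_tPS_sets_def inclusion_order_def)
qed

theorem theorem4p9:
  fixes G H F P :: "'a::{distrib_lattice, bounded_lattice} \<Rightarrow> 'a"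
  assumes "tDL_algebra G H F P"
  shows "lattice (closed_up_tPS_sets G F) \<and>
    lattice (tense_filters G H) \<and>
    lattice_iso (closed_up_tPS_sets G F) (inv_gorder (tense_filters G H)) rho \<and>
    lattice_iso (inv_gorder (tense_filters G H)) (closed_up_tPS_sets G F) sigma \<and>
    (\<forall>Y\<in>carrier (closed_up_tPS_sets G F). sigma (rho Y) = Y) \<and>
    (\<forall>S\<in>carrier (tense_filters G H). rho (sigma S) = S)"
proof -
  interpret tDL_algebra G H F P by fact
  let ?L = "closed_up_tPS_sets G F" and ?M = "inv_gorder (tense_filters G H)"
  have L: "lattice ?L" and M: "lattice ?M"
    by (rule lattice_closed_up_tPS_sets, rule lattice_inv_gorder[OF lattice_tense_filters])
  \<comment> \<open>The order of \<open>?M\<close> is reverse inclusion, so the antitone maps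
    \<open>rho\<close> and \<open>sigma\<close> become monotone.\<close>
  have rho_le: "rho Y \<sqsubseteq>\<^bsub>?M\<^esub> rho Z" if "Y \<sqsubseteq>\<^bsub>?L\<^esub> Z" for Y Z
    using that rho_antimono
    by (simp add: closed_up_tPS_sets_def tense_filters_def inclusion_order_def)
  have sigma_le: "sigma S \<sqsubseteq>\<^bsub>?L\<^esub> sigma S'" if "S \<sqsubseteq>\<^bsub>?M\<^esub> S'" for S S'
    using that sigma_antimono
    by (simp add: closed_up_tPS_sets_def tense_filters_def inclusion_order_def)
  have "lattice_iso ?L ?M rho"
    by (rule lattice_iso_of_order_iso[OF L M, where g = sigma])
      (simp_all add: rho_closed sigma_closed rho_sigma_tense_filter sigma_rho_closed_up_tPS
        rho_le[simplified] sigma_le[simplified])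
  moreover have "lattice_iso ?M ?L sigma"
    by (rule lattice_iso_of_order_iso[OF M L, where g = rho])
      (simp_all add: rho_closed sigma_closed rho_sigma_tense_filter sigma_rho_closed_up_tPS
        rho_le[simplified] sigma_le[simplified])
  ultimately show ?thesis
    using L lattice_tense_filters rho_sigma_tense_filter sigma_rho_closed_up_tPS by blast
qed

end
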